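(* For all integers $n\geq 0$ and $d\geq 1$ there is a unique element of $\bigoplus_{i\geq 0}R\,t^i\subseteq R\langle t\rangle$, namely the recursively defined polynomial $U_{n,d}$, such that for every ring $A$, every derivation $\partial$ of $A$ and every central element $h$ of $A$, $$(h\partial^d)^n = U_{n,d}\big|_{y_i=h^{[i]},\ t=\partial}=U_{n,d}(h,h^{[1]},h^{[2]},\ldots;\partial)$$ as (additive) endomorphisms of $A$.
   Context: Rings are associative and unital, not necessarily commutative. A derivation of a ring $A$ is an additive map $\partial:A\to A$ with $\partial(ab)=\partial(a)b+a\partial(b)$ for all $a,b\in A$. For $h\in A$ put $h^{[i]}=\partial^i(h)$, so $h^{[0]}=h$; $h\partial^d$ denotes the map $a\mapsto h\,\partial^d(a)$. Let $R=\mathbb{Z}[y_i;\ i\geq 0]$ be the commutative polynomial ring in the variables $y_0,y_1,y_2,\ldots$. Let $R\langle t\rangle$ be the unital ring generated over $\mathbb{Z}$ by $t$ and the $y_i$ ($i\ge 0$), subject only to the relations $y_iy_j=y_jy_i$ for all $i,j\geq 0$ (so $t$ does not commute with the $y_i$). Let $\Delta$ be the derivation of $R\langle t\rangle$ with $\Delta(y_i)=y_{i+1}$ for all $i\ge 0$ and $\Delta(t)=0$, and let $\rho_t$ be right multiplication by $t$ on $R\langle t\rangle$. For $d\ge1$ define $U_{0,d}=1$ and $U_{n+1,d}=y_0(\Delta+\rho_t)^dU_{n,d}$ for $n\ge 0$. For $W\in R\langle t\rangle$, the evaluation $W|_{y_i=h^{[i]},\,t=\partial}$ is the image of $W$ under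 the ring homomorphism $R\langle t\rangle\to\operatorname{End}(A)$ (additive endomorphisms under composition) sending $y_i$ to left multiplication by $h^{[i]}$ and $t$ to $\partial$; it is well defined because the $h^{[i]}$ commute with each other when $h$ is central. *)

theory Defs
  imports "HOL-Library.FuncSet" "HOL-Algebra.Algebra"
    "HOL-Algebra.Algebraic_Closure_Type"
begin

section \<open>The ring generated by t and the y_i, with commuting y_i\<close>

text \<open>
  The ring is built from its presentation: formal ring expressions in the generators, modulo the
  least congruence that contains the axioms of a unital ring and the relations y_i y_j = y_j y_i. The classes of GenY i and GenT are called yv i and tv.
\<close>

datatype expr =
    Zero | One | Neg expr | Add expr expr | Mul expr expr | GenY nat | GenT

inductive expr_eq :: "expr \<Rightarrow> expr \<Rightarrow> bool" where
  refl: "expr_eq a a"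
| sym: "expr_eq a b \<Longrightarrow> expr_eq b a"
| trans: "expr_eq a b \<Longrightarrow> expr_eq b c \<Longrightarrow> expr_eq a c"
| cong_neg: "expr_eq a a' \<Longrightarrow> expr_eq (Neg a) (Neg a')"
| cong_add: "expr_eq a a' \<Longrightarrow> expr_eq b b' \<Longrightarrow> expr_eq (Add a b) (Add a' b')"
| cong_mul: "expr_eq a a' \<Longrightarrow> expr_eq b b' \<Longrightarrow> expr_eq (Mul a b) (Mul a' b')"
| add_assoc: "expr_eq (Add (Add a b) c) (Add a (Add b c))"
| add_comm: "expr_eq (Add a b) (Add b a)"
| add_zero: "expr_eq (Add Zero a) a"
| add_neg: "expr_eq (Add (Neg a) a) Zero"
| mul_assoc: "expr_eq (Mul (Mul a b) c) (Mul a (Mul b c))"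
| mul_one_left: "expr_eq (Mul One a) a"
| mul_one_right: "expr_eq (Mul a One) a"
| distrib_right: "expr_eq (Mul (Add a b) c) (Add (Mul a c) (Mul b c))"
| distrib_left: "expr_eq (Mul a (Add b c)) (Add (Mul a b) (Mul a c))"
| y_commute: "expr_eq (Mul (GenY i) (GenY j)) (Mul (GenY j) (GenY i))"

quotient_type rt = expr / expr_eq
  by (auto intro!: equivpI reflpI sympI transpI intro: expr_eq.intros)

text \<open>Needed only for the class axiom 0 \<noteq> 1.\<close>

primrec const_term :: "expr \<Rightarrow> int" where
  "const_term Zero = 0"
| "const_term One = 1"
| "const_term (Neg a) = - const_term a"
| "const_term (Add a b) = const_term a + const_term b"
| "const_term (Mul a b) = const_term a * const_term b"
| "const_term (GenY i) = 0"
| "const_term GenT = 0"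

lemma const_term_cong: "expr_eq a b \<Longrightarrow> const_term a = const_term b"
  by (induction rule: expr_eq.induct) (simp_all add: algebra_simps)

instantiation rt :: ring_1
begin

lift_definition zero_rt :: rt is Zero .
lift_definition one_rt :: rt is One .
lift_definition uminus_rt :: "rt \<Rightarrow> rt" is Neg by (rule cong_neg)
lift_definition plus_rt :: "rt \<Rightarrow> rt \<Rightarrow> rt" is Add by (rule cong_add)
lift_definition times_rt :: "rt \<Rightarrow> rt \<Rightarrow> rt" is Mul by (rule cong_mul)
definition minus_rt :: "rt \<Rightarrow> rt \<Rightarrow> rt" where "minus_rt a b = a + - b"

instance
proof
  fix a b c :: rt
  show "a + b + c = a + (b + c)" by transfer (rule add_assoc)
  show "a + b = b + a" by transfer (rule add_comm)
  show "0 + a = a" by transfer (rule add_zero)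
  show "- a + a = 0" by transfer (rule add_neg)
  show "a - b = a + - b" by (rule minus_rt_def)
  show "a * b * c = a * (b * c)" by transfer (rule mul_assoc)
  show "1 * a = a" by transfer (rule mul_one_left)
  show "a * 1 = a" by transfer (rule mul_one_right)
  show "(a + b) * c = a * c + b * c" by transfer (rule distrib_right)
  show "a * (b + c) = a * b + a * c" by transfer (rule distrib_left)
  show "(0::rt) \<noteq> 1" by transfer (use const_term_cong in force)
qed

end

lift_definition yv :: "nat \<Rightarrow> rt" is GenY .
lift_definition tv :: rt is GenT .

lemma yv_mult_commute: "yv i * yv j = yv j * yv i"
  by transfer (rule y_commute)

lemma abs_rt_simps:
  "abs_rt Zero = 0" "abs_rt One = 1" "abs_rt (Neg a) = - abs_rt a"
  "abs_rt (Add a b) = abs_rt a + abs_rt b" "abs_rt (Mul a b) = abs_rt a * abs_rt b"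
  "abs_rt (GenY i) = yv i" "abs_rt GenT = tv"
  by (simp_all add: zero_rt_def one_rt_def uminus_rt.abs_eq plus_rt.abs_eq times_rt.abs_eq
      yv.abs_eq tv_def)

lemma rt_induct [case_names zero one neg add mult y t]:
  assumes "P 0" "P 1" "\<And>a. P a \<Longrightarrow> P (- a)"
    "\<And>a b. P a \<Longrightarrow> P b \<Longrightarrow> P (a + b)" "\<And>a b. P a \<Longrightarrow> P b \<Longrightarrow> P (a * b)"
    "\<And>i. P (yv i)" "P tv"
  shows "P W"
proof -
  have "P (abs_rt e)" for e
    by (induction e) (simp_all add: abs_rt_simps assms)
  then show ?thesis by (metis Quotient3_abs_rep Quotient3_rt)
qed


section \<open>The derivation of that ring and the recursively defined elements\<close>

primrec Delta_expr :: "expr \<Rightarrow> expr" where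
  "Delta_expr Zero = Zero"
| "Delta_expr One = Zero"
| "Delta_expr (Neg a) = Neg (Delta_expr a)"
| "Delta_expr (Add a b) = Add (Delta_expr a) (Delta_expr b)"
| "Delta_expr (Mul a b) = Add (Mul (Delta_expr a) b) (Mul a (Delta_expr b))"
| "Delta_expr (GenY i) = GenY (Suc i)"
| "Delta_expr GenT = Zero"

lemma abs_rt_eq: "expr_eq a b \<Longrightarrow> abs_rt a = abs_rt b"
  by (simp add: rt.abs_eq_iff)

lemma Delta_expr_cong:
  assumes "expr_eq a b"
  shows "expr_eq (Delta_expr a) (Delta_expr b)"
proof -
  from assms have "abs_rt (Delta_expr a) = abs_rt (Delta_expr b)"
    by (induction rule: expr_eq.induct)
      (use yv_mult_commute in \<open>auto dest!: abs_rt_eq simp: abs_rt_simps algebra_simps\<close>)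
  then show ?thesis by (simp add: rt.abs_eq_iff)
qed

lift_definition Delta :: "rt \<Rightarrow> rt" is Delta_expr by (rule Delta_expr_cong)

lemma Delta_simps:
  "Delta 0 = 0" "Delta 1 = 0" "Delta (- a) = - Delta a" "Delta (a + b) = Delta a + Delta b"
  "Delta (a * b) = Delta a * b + a * Delta b" "Delta (yv i) = yv (Suc i)" "Delta tv = 0"
  by (transfer, simp add: expr_eq.refl)+

lemma Delta_unique:
  assumes add: "\<And>a b. E (a + b) = E a + E b" and mult: "\<And>a b. E (a * b) = E a * b + a * E b"
    and "\<And>i. E (yv i) = yv (Suc i)" "E tv = 0"
  shows "E = Delta"
proof
  fix W
  have 0: "E 0 = 0" using add[of 0 0] by simp
  have 1: "E 1 = 0" using mult[of 1 1] by simp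
  have "E (- a) = - E a" for a using add[of "- a" a] 0 by (simp add: eq_neg_iff_add_eq_0)
  then show "E W = Delta W"
    by (induction W rule: rt_induct) (simp_all add: assms 0 1 Delta_simps)
qed

definition rho_t :: "rt \<Rightarrow> rt" where "rho_t W = W * tv"

fun Upoly :: "nat \<Rightarrow> nat \<Rightarrow> rt" where
  "Upoly 0 d = 1"
| "Upoly (Suc n) d = yv 0 * ((\<lambda>W. Delta W + rho_t W) ^^ d) (Upoly n d)"

text \<open>The polynomial ring in the y_i, as the subring of rt generated by the y_i (a retract, via t = 0).\<close>

definition Ry :: "rt set" where
  "Ry = generate_ring ring_of_type_algebra (range yv)"

text \<open>The sum over i of the left modules Ry t^i.\<close>

definition Ry_powers_t :: "rt set" where
  "Ry_powers_t = {W. \<exists>m r. (\<forall>i. r i \<in> Ry) \<and> W = (\<Sum>i<m. r i * tv ^ i)}"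


section \<open>Evaluation\<close>

text \<open>
  The ring homomorphism to S with y_i sent to f i and t sent to u; it exists and is unique
  if S is a ring, f i and u lie in S, and the f i commute (see below).
\<close>

primrec eval_expr :: "('a, 'm) ring_scheme \<Rightarrow> (nat \<Rightarrow> 'a) \<Rightarrow> 'a \<Rightarrow> expr \<Rightarrow> 'a" where
  "eval_expr S f u Zero = \<zero>\<^bsub>S\<^esub>"
| "eval_expr S f u One = \<one>\<^bsub>S\<^esub>"
| "eval_expr S f u (Neg a) = \<ominus>\<^bsub>S\<^esub> eval_expr S f u a"
| "eval_expr S f u (Add a b) = eval_expr S f u a \<oplus>\<^bsub>S\<^esub> eval_expr S f u b"
| "eval_expr S f u (Mul a b) = eval_expr S f u a \<otimes>\<^bsub>S\<^esub> eval_expr S f u b"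
| "eval_expr S f u (GenY i) = f i"
| "eval_expr S f u GenT = u"

definition eval_rt :: "('a, 'm) ring_scheme \<Rightarrow> (nat \<Rightarrow> 'a) \<Rightarrow> 'a \<Rightarrow> rt \<Rightarrow> 'a" where
  "eval_rt S f u W = eval_expr S f u (rep_rt W)"

locale eval_data = ring S for S (structure) +
  fixes f :: "nat \<Rightarrow> 'a" and u :: 'a
  assumes f_closed: "f i \<in> carrier S" and u_closed: "u \<in> carrier S"
    and f_commute: "f i \<otimes> f j = f j \<otimes> f i"
begin

lemma eval_expr_closed: "eval_expr S f u a \<in> carrier S"
  by (induction a) (simp_all add: f_closed u_closed)

lemma eval_expr_cong: "expr_eq a b \<Longrightarrow> eval_expr S f u a = eval_expr S f u b"
  by (induction rule: expr_eq.induct)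
    (simp_all add: eval_expr_closed f_commute a_ac m_assoc l_distr r_distr r_neg)

lemma eval_rt_abs: "eval_rt S f u (abs_rt a) = eval_expr S f u a"
  unfolding eval_rt_def
  by (rule eval_expr_cong) (metis Quotient3_abs_rep Quotient3_rt rt.abs_eq_iff)

lemma eval_rt_simps:
  "eval_rt S f u 0 = \<zero>" "eval_rt S f u 1 = \<one>"
  "eval_rt S f u (- a) = \<ominus> eval_rt S f u a"
  "eval_rt S f u (a + b) = eval_rt S f u a \<oplus> eval_rt S f u b"
  "eval_rt S f u (a * b) = eval_rt S f u a \<otimes> eval_rt S f u b"
  "eval_rt S f u (yv i) = f i" "eval_rt S f u tv = u"
proof -
  obtain a' b' where ab: "a = abs_rt a'" "b = abs_rt b'"
    by (metis Quotient3_abs_rep Quotient3_rt)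
  show "eval_rt S f u 0 = \<zero>" "eval_rt S f u 1 = \<one>"
    "eval_rt S f u (- a) = \<ominus> eval_rt S f u a"
    "eval_rt S f u (a + b) = eval_rt S f u a \<oplus> eval_rt S f u b"
    "eval_rt S f u (a * b) = eval_rt S f u a \<otimes> eval_rt S f u b"
    "eval_rt S f u (yv i) = f i" "eval_rt S f u tv = u"
    unfolding ab abs_rt_simps[symmetric] eval_rt_abs by simp_all
qed

lemma eval_rt_closed: "eval_rt S f u W \<in> carrier S"
  unfolding eval_rt_def by (rule eval_expr_closed)

lemma eval_rt_ring_hom: "eval_rt S f u \<in> ring_hom ring_of_type_algebra S"
  by (rule ring_hom_memI) (simp_all add: ring_of_type_algebra_def eval_rt_closed eval_rt_simps)

lemma eval_rt_unique:
  assumes "g \<in> ring_hom ring_of_type_algebra S" "\<And>i. g (yv i) = f i" "g tv = u"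
  shows "g = eval_rt S f u"
proof
  fix W
  have closed: "g a \<in> carrier S" and add: "g (a + b) = g a \<oplus> g b"
    and mult: "g (a * b) = g a \<otimes> g b" and one: "g 1 = \<one>" for a b
    using assms(1) by (auto simp: ring_hom_def ring_of_type_algebra_def)
  have zero: "g 0 = \<zero>"
    using add[of 0 0] closed[of 0] by (metis add.l_cancel_one' add_0)
  have "g (- a) = \<ominus> g a" for a
    using add[of "- a" a] closed zero by (simp add: minus_equality)
  then show "g W = eval_rt S f u W"
    by (induction W rule: rt_induct) (simp_all add: assms(2,3) zero one add mult eval_rt_simps)
qed

end


section \<open>Additive endomorphisms and derivations of a ring\<close>

text \<open>
  Maps on the carrier are represented by extensional functions, so that equality in the
  endomorphism ring is equality of maps on the carrier.
\<close>

definition add_End :: "('a, 'm) ring_scheme \<Rightarrow> ('a \<Rightarrow> 'a) ring" where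
  "add_End A = \<lparr>
    carrier = {f \<in> carrier A \<rightarrow>\<^sub>E carrier A.
      \<forall>a\<in>carrier A. \<forall>b\<in>carrier A. f (a \<oplus>\<^bsub>A\<^esub> b) = f a \<oplus>\<^bsub>A\<^esub> f b},
    monoid.mult = (\<lambda>f g. compose (carrier A) f g),
    one = (\<lambda>a\<in>carrier A. a),
    ring.zero = (\<lambda>a\<in>carrier A. \<zero>\<^bsub>A\<^esub>),
    add = (\<lambda>f g. \<lambda>a\<in>carrier A. f a \<oplus>\<^bsub>A\<^esub> g a)\<rparr>"

definition derivation :: "('a, 'm) ring_scheme \<Rightarrow> ('a \<Rightarrow> 'a) \<Rightarrow> bool" where
  "derivation A D \<longleftrightarrow> D \<in> carrier (add_End A) \<and>
    (\<forall>a\<in>carrier A. \<forall>b\<in>carrier A. D (a \<otimes>\<^bsub>A\<^esub> b) = D a \<otimes>\<^bsub>A\<^esub> b \<oplus>\<^bsub>A\<^esub> a \<otimes>\<^bsub>A\<^esub> D b)"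

definition central :: "('a, 'm) ring_scheme \<Rightarrow> 'a \<Rightarrow> bool" where
  "central A h \<longleftrightarrow> h \<in> carrier A \<and> (\<forall>a\<in>carrier A. h \<otimes>\<^bsub>A\<^esub> a = a \<otimes>\<^bsub>A\<^esub> h)"

definition left_mult :: "('a, 'm) ring_scheme \<Rightarrow> 'a \<Rightarrow> 'a \<Rightarrow> 'a" where
  "left_mult A h = (\<lambda>a\<in>carrier A. h \<otimes>\<^bsub>A\<^esub> a)"

definition mult_deriv :: "('a, 'm) ring_scheme \<Rightarrow> 'a \<Rightarrow> ('a \<Rightarrow> 'a) \<Rightarrow> nat \<Rightarrow> 'a \<Rightarrow> 'a" where
  "mult_deriv A h D d = (\<lambda>a\<in>carrier A. h \<otimes>\<^bsub>A\<^esub> (D ^^ d) a)"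

text \<open>Evaluation at y_i = D^i(h), acting by left multiplication, and t = D.\<close>

definition eval_deriv :: "('a, 'm) ring_scheme \<Rightarrow> ('a \<Rightarrow> 'a) \<Rightarrow> 'a \<Rightarrow> rt \<Rightarrow> 'a \<Rightarrow> 'a" where
  "eval_deriv A D h = eval_rt (add_End A) (\<lambda>i. left_mult A ((D ^^ i) h)) D"

lemma ring_add_End:
  assumes "ring A"
  shows "ring (add_End A)"
proof -
  interpret ring A by fact
  let ?C = "carrier A"
  have neg: "(\<lambda>a\<in>?C. \<ominus>\<^bsub>A\<^esub> f a) \<in> carrier (add_End A)"
    if "f \<in> carrier (add_End A)" for f
  proof -
    have C: "f a \<in> ?C" if "a \<in> ?C" for a
      using \<open>f \<in> carrier (add_End A)\<close> that by (auto simp: add_End_def PiE_mem)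
    with that show ?thesis by (auto simp: add_End_def minus_add)
  qed
  show ?thesis
  proof (intro ringI abelian_groupI monoidI)
    fix f g k assume F: "f \<in> carrier (add_End A)" "g \<in> carrier (add_End A)"
      "k \<in> carrier (add_End A)"
    have C: "f a \<in> ?C" "g a \<in> ?C" "k a \<in> ?C" if "a \<in> ?C" for a
      using F that by (auto simp: add_End_def PiE_mem)
    show "f \<oplus>\<^bsub>add_End A\<^esub> g \<oplus>\<^bsub>add_End A\<^esub> k = f \<oplus>\<^bsub>add_End A\<^esub> (g \<oplus>\<^bsub>add_End A\<^esub> k)"
      using C by (auto simp: add_End_def a_assoc fun_eq_iff)
    show "f \<otimes>\<^bsub>add_End A\<^esub> g \<otimes>\<^bsub>add_End A\<^esub> k = f \<otimes>\<^bsub>add_End A\<^esub> (g \<otimes>\<^bsub>add_End A\<^esub> k)"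
      using C by (auto simp: add_End_def compose_def fun_eq_iff)
    show "(f \<oplus>\<^bsub>add_End A\<^esub> g) \<otimes>\<^bsub>add_End A\<^esub> k
        = f \<otimes>\<^bsub>add_End A\<^esub> k \<oplus>\<^bsub>add_End A\<^esub> g \<otimes>\<^bsub>add_End A\<^esub> k"
      using C by (auto simp: add_End_def compose_def fun_eq_iff)
    show "k \<otimes>\<^bsub>add_End A\<^esub> (f \<oplus>\<^bsub>add_End A\<^esub> g)
        = k \<otimes>\<^bsub>add_End A\<^esub> f \<oplus>\<^bsub>add_End A\<^esub> k \<otimes>\<^bsub>add_End A\<^esub> g"
      using C F by (auto simp: add_End_def compose_def fun_eq_iff)
  next
    fix f g assume F: "f \<in> carrier (add_End A)" "g \<in> carrier (add_End A)"
    have C: "f a \<in> ?C" "g a \<in> ?C" if "a \<in> ?C" for a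
      using F that by (auto simp: add_End_def PiE_mem)
    show "f \<oplus>\<^bsub>add_End A\<^esub> g \<in> carrier (add_End A)"
      using F C by (auto simp: add_End_def a_ac)
    show "f \<otimes>\<^bsub>add_End A\<^esub> g \<in> carrier (add_End A)"
      using F C by (auto simp: add_End_def compose_def)
    show "f \<oplus>\<^bsub>add_End A\<^esub> g = g \<oplus>\<^bsub>add_End A\<^esub> f"
      using C by (auto simp: add_End_def a_comm fun_eq_iff)
  next
    fix f assume F: "f \<in> carrier (add_End A)"
    have C: "f a \<in> ?C" if "a \<in> ?C" for a
      using F that by (auto simp: add_End_def PiE_mem)
    have E: "f a = undefined" if "a \<notin> ?C" for a
      using F that by (simp add: add_End_def) (meson PiE_arb)
    show "\<zero>\<^bsub>add_End A\<^esub> \<oplus>\<^bsub>add_End A\<^esub> f = f"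
      "\<one>\<^bsub>add_End A\<^esub> \<otimes>\<^bsub>add_End A\<^esub> f = f" "f \<otimes>\<^bsub>add_End A\<^esub> \<one>\<^bsub>add_End A\<^esub> = f"
      by (simp_all add: add_End_def compose_def fun_eq_iff C E)
    have "(\<lambda>a\<in>?C. \<ominus>\<^bsub>A\<^esub> f a) \<oplus>\<^bsub>add_End A\<^esub> f = \<zero>\<^bsub>add_End A\<^esub>"
      using C by (auto simp: add_End_def l_neg fun_eq_iff)
    with neg[OF F] show "\<exists>g\<in>carrier (add_End A). g \<oplus>\<^bsub>add_End A\<^esub> f = \<zero>\<^bsub>add_End A\<^esub>"
      by blast
  qed (auto simp: add_End_def)
qed

lemma derivation_funpow_closed:
  assumes "derivation A D" "a \<in> carrier A"
  shows "(D ^^ i) a \<in> carrier A"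
  using assms by (induction i) (auto simp: derivation_def add_End_def PiE_mem)

lemma central_derivation:
  assumes "ring A" "derivation A D" "central A h"
  shows "central A (D h)"
proof -
  interpret ring A by fact
  have h: "h \<in> carrier A" and c: "\<And>a. a \<in> carrier A \<Longrightarrow> h \<otimes>\<^bsub>A\<^esub> a = a \<otimes>\<^bsub>A\<^esub> h"
    using assms by (auto simp: central_def)
  have D: "D a \<in> carrier A" if "a \<in> carrier A" for a
    using derivation_funpow_closed[OF assms(2) that, of 1] by simp
  have L: "D (a \<otimes>\<^bsub>A\<^esub> b) = D a \<otimes>\<^bsub>A\<^esub> b \<oplus>\<^bsub>A\<^esub> a \<otimes>\<^bsub>A\<^esub> D b"
    if "a \<in> carrier A" "b \<in> carrier A" for a b
    using assms(2) that by (auto simp: derivation_def)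
  have "D h \<otimes>\<^bsub>A\<^esub> a = a \<otimes>\<^bsub>A\<^esub> D h" if a: "a \<in> carrier A" for a
  proof -
    have "D h \<otimes>\<^bsub>A\<^esub> a \<oplus>\<^bsub>A\<^esub> h \<otimes>\<^bsub>A\<^esub> D a = D a \<otimes>\<^bsub>A\<^esub> h \<oplus>\<^bsub>A\<^esub> a \<otimes>\<^bsub>A\<^esub> D h"
      using L[OF h a] L[OF a h] c[OF a] by simp
    also have "\<dots> = a \<otimes>\<^bsub>A\<^esub> D h \<oplus>\<^bsub>A\<^esub> h \<otimes>\<^bsub>A\<^esub> D a"
      using a h D c[of "D a"] by (simp add: a_comm)
    finally show ?thesis using a h D by simp
  qed
  then show ?thesis using D h by (simp add: central_def)
qed

lemma central_derivation_funpow: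
  assumes "ring A" "derivation A D" "central A h"
  shows "central A ((D ^^ i) h)"
  by (induction i) (simp_all add: assms central_derivation)

lemma eval_deriv_data:
  assumes "ring A" "derivation A D" "central A h"
  shows "eval_data (add_End A) (\<lambda>i. left_mult A ((D ^^ i) h)) D"
proof -
  interpret ring A by fact
  interpret E: ring "add_End A" by (rule ring_add_End) fact
  have cl: "(D ^^ i) h \<in> carrier A" for i
    using central_derivation_funpow[OF assms] by (simp add: central_def)
  have comm: "(D ^^ i) h \<otimes>\<^bsub>A\<^esub> (D ^^ j) h = (D ^^ j) h \<otimes>\<^bsub>A\<^esub> (D ^^ i) h" for i j
    using central_derivation_funpow[OF assms, of i] cl by (simp add: central_def)
  show ?thesis
  proof
    fix i j
    show "left_mult A ((D ^^ i) h) \<in> carrier (add_End A)"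
      using cl by (auto simp: left_mult_def add_End_def r_distr)
    show "D \<in> carrier (add_End A)"
      using assms(2) by (simp add: derivation_def)
    show "left_mult A ((D ^^ i) h) \<otimes>\<^bsub>add_End A\<^esub> left_mult A ((D ^^ j) h) =
      left_mult A ((D ^^ j) h) \<otimes>\<^bsub>add_End A\<^esub> left_mult A ((D ^^ i) h)"
      using cl comm
      by (auto simp: left_mult_def add_End_def compose_def fun_eq_iff m_assoc[symmetric])
  qed
qed

end

theory Submission
  imports Defs "HOL-Library.Countable"
begin

text \<open>
  In the presented ring, \<open>t\<close> satisfies no relation with the \<open>y\<^sub>i\<close>, but after evaluation it does:
  \<open>tW\<close> and \<open>\<Delta>(W) + Wt\<close> have the same image for every \<open>W\<close>. For \<open>W = y\<^sub>i\<close> this is the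
  Leibniz rule \<open>\<partial>(h\<^sub>i a) = h\<^sub>i\<^sub>+\<^sub>1 a + h\<^sub>i \<partial>(a)\<close> with \<open>h\<^sub>i = \<partial>\<^sup>i(h)\<close>, for \<open>W = t\<close> it is trivial, and the set of
  \<open>W\<close> for which it holds is a subring because \<open>\<Delta>\<close> is a derivation, as is the commutator with
  \<open>t\<close>. So \<open>\<Delta> + \<rho>\<^sub>t\<close> evaluates as composition with \<open>\<partial>\<close> on the left, and the recursion for
  \<open>U\<^sub>n\<close> evaluates as the recursion for the powers of \<open>h\<partial>\<^sup>d\<close>
  (\<open>eval_deriv_tv_mult\<close>, \<open>mult_deriv_power_eq_eval_Upoly\<close>). That \<open>U\<^sub>n\<close> lies in the sum of the
  \<open>R t\<^sup>i\<close> is clear since \<open>\<Delta>\<close>, \<open>\<rho>\<^sub>t\<close> and left multiplication by \<open>y\<^sub>0\<close> preserve that sum.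

  For uniqueness it is enough to have one differential ring on which evaluation is injective on
  \<open>\<Oplus> R t\<^sup>i\<close>. The coefficient ring \<open>R\<close> itself works, with the derivation \<open>\<Delta>\<close> and
  \<open>h = y\<^sub>0\<close>: there \<open>\<Sum> r\<^sub>i t\<^sup>i\<close> sends \<open>y\<^sub>k\<close> to \<open>\<Sum> r\<^sub>i y\<^bsub>k+i\<^esub>\<close>. If \<open>k\<close> exceeds the index of every variable
  that occurs in the \<open>r\<^sub>i\<close>, then the substitution \<open>y\<^bsub>k+j\<^esub> \<mapsto> 1\<close>, \<open>y\<^sub>l \<mapsto> 0\<close> for the other
  \<open>l \<ge> k\<close>, turns this value into \<open>r\<^sub>j\<close>. It is an endomorphism of the presented ring, so the
  coefficients can be recovered from the presentation alone, with no basis of monomials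
  (\<open>isolate_coefficient\<close>, \<open>eval_deriv_injective_on_Ry_powers_t\<close>). Finally \<open>R\<close> is countable,
  so it has an isomorphic copy with elements in any given infinite type.
\<close>

section \<open>The coefficient ring and the left module of differential polynomials\<close>

lemma ring_rt: "ring (ring_of_type_algebra :: rt ring)"
proof -
  have "\<exists>y. x + y = 0" for x :: rt
    using add.right_inverse by blast
  then show ?thesis
    unfolding ring_of_type_algebra_def using add.right_inverse
    by unfold_locales (auto simp: algebra_simps Units_def)
qed

lemma ring_of_type_algebra_simps:
  "carrier (ring_of_type_algebra :: rt ring) = UNIV"
  "a \<otimes>\<^bsub>ring_of_type_algebra\<^esub> b = (a * b :: rt)"
  "a \<oplus>\<^bsub>ring_of_type_algebra\<^esub> b = (a + b :: rt)"
  "\<one>\<^bsub>ring_of_type_algebra\<^esub> = (1 :: rt)"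
  "\<zero>\<^bsub>ring_of_type_algebra\<^esub> = (0 :: rt)"
  "\<ominus>\<^bsub>ring_of_type_algebra\<^esub> a = (- a :: rt)"
proof -
  interpret ring "ring_of_type_algebra :: rt ring" by (rule ring_rt)
  show "\<ominus>\<^bsub>ring_of_type_algebra\<^esub> a = - a"
    by (rule minus_equality) (simp_all add: ring_of_type_algebra_def)
qed (simp_all add: ring_of_type_algebra_def)

lemma Ry_closed:
  "1 \<in> Ry" "yv i \<in> Ry" "a \<in> Ry \<Longrightarrow> - a \<in> Ry"
  "a \<in> Ry \<Longrightarrow> b \<in> Ry \<Longrightarrow> a + b \<in> Ry" "a \<in> Ry \<Longrightarrow> b \<in> Ry \<Longrightarrow> a * b \<in> Ry"
  unfolding Ry_def
  using generate_ring.intros[where R = "ring_of_type_algebra :: rt ring" and H = "range yv",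
      unfolded ring_of_type_algebra_simps]
  by auto

lemma Ry_0: "0 \<in> Ry"
  using Ry_closed(4)[OF Ry_closed(1) Ry_closed(3)[OF Ry_closed(1)]] by simp

lemma Ry_induct [consumes 1, case_names one y neg add mult]:
  assumes "r \<in> Ry" "P 1" "\<And>i. P (yv i)" "\<And>a. a \<in> Ry \<Longrightarrow> P a \<Longrightarrow> P (- a)"
    "\<And>a b. a \<in> Ry \<Longrightarrow> b \<in> Ry \<Longrightarrow> P a \<Longrightarrow> P b \<Longrightarrow> P (a + b)"
    "\<And>a b. a \<in> Ry \<Longrightarrow> b \<in> Ry \<Longrightarrow> P a \<Longrightarrow> P b \<Longrightarrow> P (a * b)"
  shows "P r"
proof -
  from assms(1) have "r \<in> generate_ring ring_of_type_algebra (range yv)"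
    by (simp add: Ry_def)
  then show ?thesis
    by induction
      (auto simp: ring_of_type_algebra_simps Ry_def[symmetric] intro: assms(2-6))
qed

lemma Ry_commute_yv: "r \<in> Ry \<Longrightarrow> yv i * r = r * yv i"
proof (induction rule: Ry_induct)
  case (mult a b)
  have "yv i * (a * b) = (a * yv i) * b"
    by (simp only: mult.IH mult.assoc[symmetric])
  also have "\<dots> = a * (b * yv i)" by (simp only: mult.IH mult.assoc)
  finally show ?case by (simp only: mult.assoc)
qed (simp_all add: yv_mult_commute algebra_simps)

lemma Delta_Ry: "r \<in> Ry \<Longrightarrow> Delta r \<in> Ry"
  by (induction rule: Ry_induct) (simp_all add: Delta_simps Ry_closed Ry_0)

lemma Delta_funpow_Ry: "r \<in> Ry \<Longrightarrow> (Delta ^^ i) r \<in> Ry"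
  by (induction i) (simp_all add: Delta_Ry)

lemma sum_Ry: "(\<And>i. i < m \<Longrightarrow> r i \<in> Ry) \<Longrightarrow> (\<Sum>i<m. r i) \<in> Ry" for m :: nat
  by (induction m) (simp_all add: Ry_0 Ry_closed)

lemma Delta_funpow_yv: "(Delta ^^ i) (yv k) = yv (k + i)"
  by (induction i) (simp_all add: Delta_simps)

lemma Delta_tv_power: "Delta (tv ^ i) = 0"
  by (induction i) (simp_all add: Delta_simps)

lemma Delta_sum: "Delta (\<Sum>i<m. r i) = (\<Sum>i<m. Delta (r i))" for m :: nat
  by (induction m) (simp_all add: Delta_simps)

text \<open>
  Elements are handled through an arbitrary representation, not through well-defined
  coefficients; two of them are added or compared after padding with zeros to a common length.
\<close>

lemma Ry_powers_t_pad:
  assumes "\<forall>i. r i \<in> Ry" "W = (\<Sum>i<m. r i * tv ^ i)" "m \<le> m'"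
  obtains r' where "\<forall>i. r' i \<in> Ry" "W = (\<Sum>i<m'. r' i * tv ^ i)"
proof
  define r' where "r' = (\<lambda>i. if i < m then r i else 0)"
  show "\<forall>i. r' i \<in> Ry" using assms(1) by (simp add: r'_def Ry_0)
  have "(\<Sum>i<m'. r' i * tv ^ i) = (\<Sum>i<m. r' i * tv ^ i)"
    by (rule sum.mono_neutral_right) (use assms(3) in \<open>auto simp: r'_def\<close>)
  then show "W = (\<Sum>i<m'. r' i * tv ^ i)" by (simp add: assms(2) r'_def)
qed

lemma Ry_powers_t_common_degree:
  assumes "V \<in> Ry_powers_t" "W \<in> Ry_powers_t"
  obtains m r s where "\<forall>i. r i \<in> Ry" "V = (\<Sum>i<m. r i * tv ^ i)"
    "\<forall>i. s i \<in> Ry" "W = (\<Sum>i<m. s i * tv ^ i)"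
proof -
  obtain m1 m2 r s where *: "\<forall>i. r i \<in> Ry" "V = (\<Sum>i<m1. r i * tv ^ i)"
    "\<forall>i. s i \<in> Ry" "W = (\<Sum>i<m2. s i * tv ^ i)"
    using assms by (auto simp: Ry_powers_t_def)
  show thesis
    by (rule Ry_powers_t_pad[OF *(1,2) max.cobounded1[of m1 m2]],
        rule Ry_powers_t_pad[OF *(3,4) max.cobounded2[of m2 m1]], rule that)
qed

lemma Ry_powers_t_1: "1 \<in> Ry_powers_t"
  unfolding Ry_powers_t_def
  by (intro CollectI exI[of _ 1] exI[of _ "\<lambda>_. 1"]) (simp add: Ry_closed)

lemma Ry_powers_t_add:
  assumes "V \<in> Ry_powers_t" "W \<in> Ry_powers_t"
  shows "V + W \<in> Ry_powers_t"
proof -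
  obtain m r s where "\<forall>i. r i \<in> Ry" "V = (\<Sum>i<m. r i * tv ^ i)"
    "\<forall>i. s i \<in> Ry" "W = (\<Sum>i<m. s i * tv ^ i)"
    using Ry_powers_t_common_degree[OF assms] .
  then show ?thesis
    unfolding Ry_powers_t_def
    by (intro CollectI exI[of _ m] exI[of _ "\<lambda>i. r i + s i"])
      (simp add: Ry_closed ring_distribs sum.distrib)
qed

lemma Ry_powers_t_mult_left:
  assumes "r \<in> Ry" "W \<in> Ry_powers_t"
  shows "r * W \<in> Ry_powers_t"
proof -
  obtain m s where "\<forall>i. s i \<in> Ry" "W = (\<Sum>i<m. s i * tv ^ i)"
    using assms(2) by (auto simp: Ry_powers_t_def)
  then show ?thesis
    unfolding Ry_powers_t_def
    by (intro CollectI exI[of _ m] exI[of _ "\<lambda>i. r * s i"])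
      (simp add: Ry_closed assms(1) sum_distrib_left mult.assoc)
qed

lemma Ry_powers_t_Delta:
  assumes "W \<in> Ry_powers_t"
  shows "Delta W \<in> Ry_powers_t"
proof -
  obtain m s where "\<forall>i. s i \<in> Ry" "W = (\<Sum>i<m. s i * tv ^ i)"
    using assms by (auto simp: Ry_powers_t_def)
  then show ?thesis
    unfolding Ry_powers_t_def
    by (intro CollectI exI[of _ m] exI[of _ "\<lambda>i. Delta (s i)"])
      (simp add: Delta_Ry Delta_sum Delta_simps Delta_tv_power)
qed

lemma Ry_powers_t_rho_t:
  assumes "W \<in> Ry_powers_t"
  shows "rho_t W \<in> Ry_powers_t"
proof -
  obtain m s where "\<forall>i. s i \<in> Ry" "W = (\<Sum>i<m. s i * tv ^ i)"
    using assms by (auto simp: Ry_powers_t_def)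
  moreover define s' where "s' = (\<lambda>i. case i of 0 \<Rightarrow> 0 | Suc j \<Rightarrow> s j)"
  ultimately have "\<forall>i. s' i \<in> Ry" "rho_t W = (\<Sum>i<Suc m. s' i * tv ^ i)"
    unfolding sum.lessThan_Suc_shift
    by (auto simp: s'_def rho_t_def Ry_0 sum_distrib_right mult.assoc power_Suc2
        simp del: power_Suc split: nat.split)
  then show ?thesis unfolding Ry_powers_t_def by blast
qed

lemma Upoly_in_Ry_powers_t: "Upoly n d \<in> Ry_powers_t"
proof (induction n)
  case (Suc n)
  have "((\<lambda>W. Delta W + rho_t W) ^^ k) (Upoly n d) \<in> Ry_powers_t" for k
    by (induction k) (simp_all add: Suc Ry_powers_t_add Ry_powers_t_Delta Ry_powers_t_rho_t)
  then show ?case by (simp add: Ry_powers_t_mult_left Ry_closed)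
qed (simp add: Ry_powers_t_1)


section \<open>Powers of a multiple of a power of a derivation\<close>

text \<open>
  Evaluation does not see the difference between \<open>\<Delta>\<close> and the commutator with \<open>t\<close>. In the
  product case, \<open>t\<close> is moved past \<open>a\<close> and then past \<open>b\<close>; the two correction terms add up to
  \<open>\<Delta>(ab)\<close>.
\<close>

lemma eval_deriv_tv_mult:
  assumes "ring A" "derivation A D" "central A h"
  shows "eval_deriv A D h (tv * W) = eval_deriv A D h (Delta W + rho_t W)"
proof -
  interpret E: eval_data "add_End A" "\<lambda>i. left_mult A ((D ^^ i) h)" D
    by (rule eval_deriv_data) fact+
  interpret A: ring A by fact
  let ?e = "eval_rt (add_End A) (\<lambda>i. left_mult A ((D ^^ i) h)) D"
  note e = E.eval_rt_simps and c = E.eval_rt_closed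
  have "?e (tv * W) = ?e (Delta W + W * tv)"
  proof (induction W rule: rt_induct)
    case (neg a)
    have "?e (tv * - a) = ?e (- (tv * a))" by simp
    also have "\<dots> = ?e (- (Delta a + a * tv))" by (simp only: e(3) neg)
    finally show ?case by (simp add: Delta_simps algebra_simps)
  next
    case (add a b)
    have "?e (tv * (a + b)) = ?e (tv * a + tv * b)" by (simp add: algebra_simps)
    also have "\<dots> = ?e ((Delta a + a * tv) + (Delta b + b * tv))"
      by (simp only: e(4) add)
    finally show ?case by (simp add: Delta_simps algebra_simps)
  next
    case (mult a b)
    have "?e (tv * (a * b)) = ?e ((tv * a) * b)" by (simp add: mult.assoc)
    also have "\<dots> = ?e ((Delta a + a * tv) * b)" by (simp only: e(5)[of _ b] mult)
    also have "\<dots> = ?e (Delta a * b + a * (tv * b))" by (simp add: algebra_simps)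
    also have "\<dots> = ?e (Delta a * b + a * (Delta b + b * tv))"
      by (simp only: e(4) e(5)[of a] mult)
    finally show ?case by (simp add: Delta_simps algebra_simps)
  next
    case (y i)
    have cl: "(D ^^ j) h \<in> carrier A" for j
      using central_derivation_funpow[OF assms] by (simp add: central_def)
    have D: "D a \<in> carrier A" if "a \<in> carrier A" for a
      using derivation_funpow_closed[OF assms(2) that, of 1] by simp
    have L: "D (a \<otimes>\<^bsub>A\<^esub> b) = D a \<otimes>\<^bsub>A\<^esub> b \<oplus>\<^bsub>A\<^esub> a \<otimes>\<^bsub>A\<^esub> D b"
      if "a \<in> carrier A" "b \<in> carrier A" for a b
      using assms(2) that by (auto simp: derivation_def)
    \<comment> \<open>the Leibniz rule for the product of \<open>D\<^sup>i(h)\<close> and the argument\<close>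
    show ?case
      by (simp add: e Delta_simps)
        (use L cl D in \<open>auto simp: add_End_def left_mult_def compose_def fun_eq_iff\<close>)
  qed (simp_all add: Delta_simps)
  then show ?thesis by (simp add: eval_deriv_def rho_t_def)
qed

lemma eval_deriv_monomial:
  assumes "ring A" "derivation A D" "central A h"
  shows "eval_deriv A D h (yv 0 * tv ^ d) = mult_deriv A h D d"
proof -
  interpret E: eval_data "add_End A" "\<lambda>i. left_mult A ((D ^^ i) h)" D
    by (rule eval_deriv_data) fact+
  have pow: "eval_deriv A D h (tv ^ d) = (\<lambda>a\<in>carrier A. (D ^^ d) a)"
  proof (induction d)
    case 0
    show ?case by (simp add: eval_deriv_def E.eval_rt_simps) (simp add: add_End_def)
  next
    case (Suc d)
    have "eval_deriv A D h (tv ^ Suc d) = compose (carrier A) D (eval_deriv A D h (tv ^ d))"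
      by (simp add: eval_deriv_def E.eval_rt_simps) (simp add: add_End_def)
    then show ?case by (simp add: Suc compose_def fun_eq_iff)
  qed
  have "eval_deriv A D h (yv 0 * tv ^ d) = compose (carrier A) (left_mult A h) (eval_deriv A D h (tv ^ d))"
    by (simp add: eval_deriv_def E.eval_rt_simps) (simp add: add_End_def)
  then show ?thesis
    using derivation_funpow_closed[OF assms(2)]
    by (auto simp: pow mult_deriv_def left_mult_def compose_def fun_eq_iff)
qed

text \<open>
  Both sides are the value of \<open>(y\<^sub>0 t\<^sup>d)\<^sup>n\<close>: peeling off the leftmost factor of the power matches the
  recursion for \<open>U\<close>, since \<open>(\<Delta> + \<rho>\<^sub>t)\<^sup>d\<close> has the same effect under evaluation as left
  multiplication by \<open>t\<^sup>d\<close>.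
\<close>

lemma mult_deriv_power_eq_eval_Upoly:
  assumes "ring A" "derivation A D" "central A h"
  shows "mult_deriv A h D d [^]\<^bsub>add_End A\<^esub> n = eval_deriv A D h (Upoly n d)"
proof (induction n)
  interpret E: eval_data "add_End A" "\<lambda>i. left_mult A ((D ^^ i) h)" D
    by (rule eval_deriv_data) fact+
  let ?e = "eval_deriv A D h"
  have e: "?e 1 = \<one>\<^bsub>add_End A\<^esub>" "?e (a * b) = ?e a \<otimes>\<^bsub>add_End A\<^esub> ?e b"
    "?e a \<in> carrier (add_End A)" for a b
    by (simp_all add: eval_deriv_def E.eval_rt_simps E.eval_rt_closed)
  {
    case 0
    show ?case by (simp add: e)
  next
    case (Suc n)
    let ?M = "mult_deriv A h D d"
    have M: "?M = ?e (yv 0 * tv ^ d)" by (simp add: eval_deriv_monomial[OF assms])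
    have step: "?e (((\<lambda>W. Delta W + rho_t W) ^^ k) W) = ?e (tv ^ k * W)" for k W
    proof (induction k)
      case (Suc k)
      let ?V = "((\<lambda>W. Delta W + rho_t W) ^^ k) W"
      have "?e (Delta ?V + rho_t ?V) = ?e (tv * ?V)"
        by (rule eval_deriv_tv_mult[OF assms, symmetric])
      also have "\<dots> = ?e (tv * (tv ^ k * W))" by (simp only: e(2)[of tv] Suc)
      finally show ?case by (simp add: mult.assoc)
    qed simp
    have "?M [^]\<^bsub>add_End A\<^esub> Suc n = ?M \<otimes>\<^bsub>add_End A\<^esub> ?M [^]\<^bsub>add_End A\<^esub> n"
      by (rule E.nat_pow_Suc2) (simp add: M e)
    also have "\<dots> = ?e ((yv 0 * tv ^ d) * Upoly n d)" 
      by (simp only: Suc e(2)[of "yv 0 * tv ^ d"] M[symmetric])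
    also have "\<dots> = ?e (yv 0 * (tv ^ d * Upoly n d))" by (simp add: mult.assoc)
    also have "\<dots> = ?e (Upoly (Suc n) d)" by (simp add: e(2)[of "yv 0"] step)
    finally show ?case .
  }
qed


section \<open>The coefficient ring as a test differential ring\<close>

text \<open>
  The differential ring \<open>(R, \<Delta>)\<close>, transported along an injection so that its elements have a
  prescribed type; \<open>h\<close> will be the copy of \<open>y\<^sub>0\<close>. The whole ring generated by \<open>t\<close> and the \<open>y\<^sub>i\<close>
  would not do, because \<open>y\<^sub>0\<close> is not central in it.
\<close>

locale Ry_copy =
  fixes g :: "rt \<Rightarrow> 'b"
  assumes inj: "inj g"
begin

definition A :: "'b ring" where
  "A = image_ring g (ring_of_type_algebra\<lparr>carrier := Ry\<rparr>)"

definition D :: "'b \<Rightarrow> 'b" where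
  "D = (\<lambda>x\<in>g ` Ry. g (Delta (inv_into UNIV g x)))"

lemma carrier_A: "carrier A = g ` Ry"
  by (simp add: A_def image_ring_carrier)

lemma inv_into_Ry: "a \<in> Ry \<Longrightarrow> inv_into Ry g (g a) = a"
  using inj by (simp add: inv_into_f_f inj_on_subset)

lemma A_simps:
  "a \<in> Ry \<Longrightarrow> b \<in> Ry \<Longrightarrow> g a \<otimes>\<^bsub>A\<^esub> g b = g (a * b)"
  "a \<in> Ry \<Longrightarrow> b \<in> Ry \<Longrightarrow> g a \<oplus>\<^bsub>A\<^esub> g b = g (a + b)"
  "\<zero>\<^bsub>A\<^esub> = g 0" "\<one>\<^bsub>A\<^esub> = g 1"
  by (simp_all add: A_def image_ring_def image_group_def monoid.defs
      ring_of_type_algebra_simps inv_into_Ry)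

lemma ring_A: "ring A"
proof -
  interpret R: ring "ring_of_type_algebra :: rt ring" by (rule ring_rt)
  have "ring (ring_of_type_algebra\<lparr>carrier := Ry\<rparr>)"
    unfolding Ry_def by (rule R.generate_ring_is_ring) (simp add: ring_of_type_algebra_simps)
  then show ?thesis
    unfolding A_def by (rule ring.inj_imp_image_ring_is_ring) (simp add: inj_on_subset[OF inj])
qed

sublocale A: ring A by (rule ring_A)

lemma A_neg: "a \<in> Ry \<Longrightarrow> \<ominus>\<^bsub>A\<^esub> g a = g (- a)"
  by (rule A.minus_equality) (simp_all add: A_simps carrier_A Ry_closed)

lemma D_g: "a \<in> Ry \<Longrightarrow> D (g a) = g (Delta a)"
  by (simp add: D_def inj)

lemma D_funpow_g: "a \<in> Ry \<Longrightarrow> (D ^^ i) (g a) = g ((Delta ^^ i) a)"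
  by (induction i) (simp_all add: D_g Delta_funpow_Ry)

lemma derivation_D: "derivation A D"
proof -
  have "D \<in> carrier A \<rightarrow>\<^sub>E carrier A"
    unfolding carrier_A by (auto simp: D_g Delta_Ry) (simp add: D_def)
  then show ?thesis
    by (auto simp: derivation_def add_End_def carrier_A D_g A_simps Ry_closed Delta_simps Delta_Ry)
qed

lemma central_y0: "central A (g (yv 0))"
  by (auto simp: central_def carrier_A A_simps Ry_closed Ry_commute_yv)

abbreviation ev :: "rt \<Rightarrow> 'b \<Rightarrow> 'b" where
  "ev \<equiv> eval_deriv A D (g (yv 0))"

sublocale E: eval_data "add_End A" "\<lambda>i. left_mult A ((D ^^ i) (g (yv 0)))" D
  by (rule eval_deriv_data[OF ring_A derivation_D central_y0])

lemma ev_add: "a \<in> Ry \<Longrightarrow> ev (V + W) (g a) = ev V (g a) \<oplus>\<^bsub>A\<^esub> ev W (g a)"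
  by (simp add: eval_deriv_def E.eval_rt_simps) (simp add: add_End_def carrier_A)

lemma ev_mult: "a \<in> Ry \<Longrightarrow> ev (V * W) (g a) = ev V (ev W (g a))"
  by (simp add: eval_deriv_def E.eval_rt_simps) (simp add: add_End_def carrier_A compose_def)

lemma ev_0: "a \<in> Ry \<Longrightarrow> ev 0 (g a) = g 0"
  by (simp add: eval_deriv_def E.eval_rt_simps) (simp add: add_End_def carrier_A A_simps)

lemma ev_1: "a \<in> Ry \<Longrightarrow> ev 1 (g a) = g a"
  by (simp add: eval_deriv_def E.eval_rt_simps) (simp add: add_End_def carrier_A)

text \<open>
  An element of \<open>R\<close> acts on \<open>R\<close> by multiplication with itself, because \<open>y\<^sub>i\<close> acts as
  \<open>\<Delta>\<^sup>i(y\<^sub>0) = y\<^sub>i\<close>.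
\<close>

lemma ev_Ry: "r \<in> Ry \<Longrightarrow> a \<in> Ry \<Longrightarrow> ev r (g a) = g (r * a)"
proof (induction arbitrary: a rule: Ry_induct)
  case (y i)
  then show ?case
    by (simp add: eval_deriv_def E.eval_rt_simps)
      (simp add: left_mult_def carrier_A D_funpow_g Delta_funpow_yv A_simps Ry_closed)
next
  case (neg r)
  have "ev (- r) (g a) \<oplus>\<^bsub>A\<^esub> ev r (g a) = \<zero>\<^bsub>A\<^esub>"
    using neg ev_add[of a "- r" r] by (simp add: ev_0 A_simps)
  moreover have "ev (- r) (g a) \<in> carrier A"
    using E.eval_rt_closed[of "- r"] neg(3)
    by (auto simp: eval_deriv_def add_End_def carrier_A PiE_mem)
  ultimately have "\<ominus>\<^bsub>A\<^esub> ev r (g a) = ev (- r) (g a)"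
    by (intro A.minus_equality) (simp_all add: neg Ry_closed carrier_A)
  then show ?case using neg by (simp add: A_neg Ry_closed)
qed (simp_all add: ev_1 ev_add ev_mult A_simps Ry_closed algebra_simps)

lemma ev_tv_power: "a \<in> Ry \<Longrightarrow> ev (tv ^ i) (g a) = g ((Delta ^^ i) a)"
proof (induction i)
  case (Suc i)
  have "ev tv = D" by (simp add: eval_deriv_def E.eval_rt_simps)
  with Suc show ?case by (simp add: ev_mult D_g Delta_funpow_Ry)
qed (simp add: ev_1)

lemma ev_differential_polynomial:
  assumes "\<forall>i. r i \<in> Ry" "a \<in> Ry"
  shows "ev (\<Sum>i<m. r i * tv ^ i) (g a) = g (\<Sum>i<m. r i * (Delta ^^ i) a)"
proof (induction m)
  case (Suc m)
  have "(\<Sum>i<m. r i * (Delta ^^ i) a) \<in> Ry"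
    by (rule sum_Ry) (simp add: assms Ry_closed Delta_funpow_Ry)
  with Suc show ?case
    by (simp add: assms ev_add ev_mult ev_tv_power ev_Ry Delta_funpow_Ry A_simps Ry_closed)
qed (simp add: ev_0 assms)

end

instance expr :: countable
  by countable_datatype

lemma inj_from_rt:
  assumes "infinite (UNIV :: 'b set)"
  obtains g :: "rt \<Rightarrow> 'b" where "inj g"
proof -
  obtain f :: "nat \<Rightarrow> 'b" where "inj f"
    using infinite_countable_subset[OF assms] by blast
  moreover have "inj rep_rt"
    by (rule inj_on_inverseI[of _ abs_rt]) (rule Quotient3_abs_rep[OF Quotient3_rt])
  ultimately have "inj (f \<circ> to_nat \<circ> rep_rt)"
    by (intro inj_compose) simp_all
  then show thesis by (rule that)
qed


section \<open>Isolating a coefficient\<close>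

text \<open>
  If the \<open>r\<^sub>i\<close> involve only variables \<open>y\<^sub>l\<close> with \<open>l < k\<close>, then this endomorphism sends
  \<open>\<Sum> r\<^sub>i y\<^bsub>k+i\<^esub>\<close> to \<open>r\<^sub>j\<close>.
\<close>

definition isolate :: "nat \<Rightarrow> nat \<Rightarrow> rt \<Rightarrow> rt" where
  "isolate k j = eval_rt ring_of_type_algebra
     (\<lambda>i. if i < k then yv i else if i = k + j then 1 else 0) tv"

lemma isolate_simps:
  "isolate k j 0 = 0" "isolate k j 1 = 1" "isolate k j (- a) = - isolate k j a"
  "isolate k j (a + b) = isolate k j a + isolate k j b"
  "isolate k j (a * b) = isolate k j a * isolate k j b"
  "isolate k j (yv i) = (if i < k then yv i else if i = k + j then 1 else 0)"
  "isolate k j tv = tv"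
proof -
  interpret ring "ring_of_type_algebra :: rt ring" by (rule ring_rt)
  interpret eval_data "ring_of_type_algebra :: rt ring"
    "\<lambda>i. if i < k then yv i else if i = k + j then 1 else 0" tv
    by unfold_locales (simp_all add: ring_of_type_algebra_simps yv_mult_commute)
  show "isolate k j 0 = 0" "isolate k j 1 = 1" "isolate k j (- a) = - isolate k j a"
    "isolate k j (a + b) = isolate k j a + isolate k j b"
    "isolate k j (a * b) = isolate k j a * isolate k j b"
    "isolate k j (yv i) = (if i < k then yv i else if i = k + j then 1 else 0)"
    "isolate k j tv = tv"
    unfolding isolate_def by (simp_all only: eval_rt_simps ring_of_type_algebra_simps)
qed

lemma isolate_sum: "isolate k j (\<Sum>i<m. r i) = (\<Sum>i<m. isolate k j (r i))" for m :: nat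
  by (induction m) (simp_all add: isolate_simps)

text \<open>
  An element involves only finitely many variables. Stating this as invariance under substitution
  avoids a notion of occurrence, which is awkward modulo the relations.
\<close>

lemma isolate_fixes_eventually: "\<exists>K. \<forall>k\<ge>K. \<forall>j. isolate k j W = W"
proof (induction W rule: rt_induct)
  case (add a b)
  then obtain K L where "\<forall>k\<ge>K. \<forall>j. isolate k j a = a" "\<forall>k\<ge>L. \<forall>j. isolate k j b = b" by blast
  then show ?case by (intro exI[of _ "max K L"]) (simp add: isolate_simps)
next
  case (mult a b)
  then obtain K L where "\<forall>k\<ge>K. \<forall>j. isolate k j a = a" "\<forall>k\<ge>L. \<forall>j. isolate k j b = b" by blast
  then show ?case by (intro exI[of _ "max K L"]) (simp add: isolate_simps)
next
  case (y i)
  show ?case by (intro exI[of _ "Suc i"]) (simp add: isolate_simps)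
qed (auto simp: isolate_simps)

lemma isolate_coefficient:
  assumes "\<And>i. i < m \<Longrightarrow> isolate k j (r i) = r i" "j < m"
  shows "isolate k j (\<Sum>i<m. r i * yv (k + i)) = r j"
  using assms by (simp add: isolate_sum isolate_simps if_distrib[of "(*) _"] cong: if_cong)

lemma coefficients_eq_if_values_eq:
  assumes eq: "\<And>k. (\<Sum>i<m. r i * yv (k + i)) = (\<Sum>i<m. s i * yv (k + i))" and "j < m"
  shows "r j = s j"
proof -
  have bound: "\<exists>K. \<forall>k\<ge>K. \<forall>i<m. isolate k j (r i) = r i" for r :: "nat \<Rightarrow> rt"
  proof -
    obtain K where K: "\<forall>k\<ge>K i. isolate k j (r i) = r i" for i
      using isolate_fixes_eventually[of "r _"] by metis
    show ?thesis
    proof (intro exI allI impI)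
      fix k i assume "Max (K ` {..<m}) \<le> k" "i < m"
      have "K i \<le> Max (K ` {..<m})" by (rule Max_ge) (use \<open>i < m\<close> in auto)
      also have "\<dots> \<le> k" by fact
      finally have "K i \<le> k" .
      then show "isolate k j (r i) = r i" using K by blast
    qed
  qed
  from bound[of r] bound[of s] obtain K L
    where "\<forall>k\<ge>K. \<forall>i<m. isolate k j (r i) = r i" "\<forall>k\<ge>L. \<forall>i<m. isolate k j (s i) = s i" by blast
  then have "\<forall>i<m. isolate (max K L) j (r i) = r i" "\<forall>i<m. isolate (max K L) j (s i) = s i"
    by simp_all
  then show ?thesis
    using isolate_coefficient[of m "max K L" j r] isolate_coefficient[of m "max K L" j s]
      eq[of "max K L"] assms(2) by simp
qed

text \<open>
  On the copy of \<open>(R, \<Delta>)\<close>, the operators already differ at some \<open>y\<^sub>k\<close> if \<open>V \<noteq> W\<close>. No single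
  \<open>k\<close> serves all pairs: \<open>y\<^sub>1 - y\<^sub>0 t\<close>, for example, kills \<open>y\<^sub>0\<close>.
\<close>

lemma eval_deriv_injective_on_Ry_powers_t:
  assumes "infinite (UNIV :: 'b set)" "V \<in> Ry_powers_t" "W \<in> Ry_powers_t"
    and eq: "\<And>(A :: 'b ring) D h. ring A \<Longrightarrow> derivation A D \<Longrightarrow> central A h \<Longrightarrow>
      eval_deriv A D h V = eval_deriv A D h W"
  shows "V = W"
proof -
  obtain g :: "rt \<Rightarrow> 'b" where "inj g" using inj_from_rt[OF assms(1)] .
  then interpret Ry_copy g by (rule Ry_copy.intro)
  obtain m r s where VW: "\<forall>i. r i \<in> Ry" "V = (\<Sum>i<m. r i * tv ^ i)"
    "\<forall>i. s i \<in> Ry" "W = (\<Sum>i<m. s i * tv ^ i)"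
    using Ry_powers_t_common_degree[OF assms(2,3)] .
  have "(\<Sum>i<m. r i * yv (k + i)) = (\<Sum>i<m. s i * yv (k + i))" for k
  proof -
    have "ev V (g (yv k)) = ev W (g (yv k))"
      by (simp add: eq[OF ring_A derivation_D central_y0])
    then have "g (\<Sum>i<m. r i * yv (k + i)) = g (\<Sum>i<m. s i * yv (k + i))"
      by (simp add: VW ev_differential_polynomial Ry_closed Delta_funpow_yv)
    then show ?thesis using inj by (simp add: inj_eq)
  qed
  then have "r j = s j" if "j < m" for j
    using coefficients_eq_if_values_eq that by blast
  then show ?thesis by (simp add: VW)
qed

theorem theorem6p2:
  fixes n d :: nat
  assumes "d \<ge> 1"
    and "infinite (UNIV :: 'b set)"
  shows "Upoly n d \<in> Ry_powers_t
    \<and> (\<forall>(A :: 'a ring) D h. ring A \<and> derivation A D \<and> central A h \<longrightarrow>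
          mult_deriv A h D d [^]\<^bsub>add_End A\<^esub> n = eval_deriv A D h (Upoly n d))
    \<and> (\<forall>W \<in> Ry_powers_t.
          (\<forall>(A :: 'b ring) D h. ring A \<and> derivation A D \<and> central A h \<longrightarrow>
             mult_deriv A h D d [^]\<^bsub>add_End A\<^esub> n = eval_deriv A D h W)
          \<longrightarrow> W = Upoly n d)"
proof (intro conjI ballI impI allI)
  show "Upoly n d \<in> Ry_powers_t" by (rule Upoly_in_Ry_powers_t)
next
  fix A :: "'a ring" and D h
  assume "ring A \<and> derivation A D \<and> central A h"
  then show "mult_deriv A h D d [^]\<^bsub>add_End A\<^esub> n = eval_deriv A D h (Upoly n d)"
    by (simp add: mult_deriv_power_eq_eval_Upoly)
next
  fix W
  assume "W \<in> Ry_powers_t" and "\<forall>(A :: 'b ring) D h. ring A \<and> derivation A D \<and> central A h \<longrightarrow>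
    mult_deriv A h D d [^]\<^bsub>add_End A\<^esub> n = eval_deriv A D h W"
  then show "W = Upoly n d"
    by (intro eval_deriv_injective_on_Ry_powers_t[OF assms(2)] Upoly_in_Ry_powers_t)
      (simp_all add: mult_deriv_power_eq_eval_Upoly[symmetric])
qed

end
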